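(* Let $\mathcal{P}$ be a problem on signed graphs that can be solved in \textsf{FPT}-time when parameterized by the signed neighborhood diversity. Then $\mathcal{P}$ can also be solved in \textsf{FPT}-time when parameterized by any of the following: (1) the vertex cover number of the underlying unsigned graph; (2) the distance to $k$-balanced complete graph together with $k$; (3) the distance to $k$-anti-balanced complete graph together with $k$.
   Context: A signed graph is a triple $G=(V,E^+,E^-)$ with $V$ finite, $E^+,E^-\subseteq\binom{V}{2}$ and $E^+\cap E^-=\emptyset$; its underlying unsigned graph is $(V,E^+\cup E^-)$. $N^+(v)=\{u: uv\in E^+\}$, $N^-(v)=\{u: uv\in E^-\}$. The signed neighborhood diversity $\textsf{snd}(G)$ is the least integer $k$ such that $V$ can be partitioned into $k$ classes where, for each class $C$ and any $u,v\in C$, $N^+(v)\setminus\{u\}=N^+(u)\setminus\{v\}$ and $N^-(v)\setminus\{u\}=N^-(u)\setminus\{v\}$. A signed graph is complete if $E^+\cup E^-=\binom{V}{2}$; a complete signed graph is $k$-balanced if $(V,E^+)$ has exactly $k$ connected components, and $k$-anti-balanced if $(V,E^-)$ has exactly $k$ connected components. The distance to $k$-balanced (resp. $k$-anti-balanced) complete graph of $G$ is the minimum number of vertices whose deletion from $G$ yields a $k$-balanced (resp. $k$-anti-balanced) complete signed graph.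
   Formalization: A complete signed graph counts as k-balanced (k-anti-balanced) only if, besides (V,E^+) (resp. (V,E^-)) having exactly k components, no negative (resp. positive) edge lies inside a component; without this, (2) and (3) fail, e.g. a positive path with all other pairs negative has snd = n. *)

theory Defs
  imports "HOL-Library.Extended_Nat" "HOL-Library.Disjoint_Sets" "HOL-Library.Ramsey"
begin

section \<open>Signed graphs\<close>

record 'a sgraph =
  verts :: "'a set"
  pos :: "'a set set"
  neg :: "'a set set"

text \<open>\<open>nsets V 2\<close> is the set of two-element subsets of \<open>V\<close>.\<close>

definition signed_graph :: "'a sgraph \<Rightarrow> bool" where
  "signed_graph G \<longleftrightarrow> finite (verts G) \<and> pos G \<subseteq> nsets (verts G) 2 \<and>
     neg G \<subseteq> nsets (verts G) 2 \<and> pos G \<inter> neg G = {}"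

definition nbh :: "'a set set \<Rightarrow> 'a \<Rightarrow> 'a set" where
  "nbh E v = {u. {u, v} \<in> E}"

definition same_signed_type :: "'a sgraph \<Rightarrow> 'a \<Rightarrow> 'a \<Rightarrow> bool" where
  "same_signed_type G u v \<longleftrightarrow>
     nbh (pos G) v - {u} = nbh (pos G) u - {v} \<and>
     nbh (neg G) v - {u} = nbh (neg G) u - {v}"

definition snd_number :: "'a sgraph \<Rightarrow> nat" where
  "snd_number G = (LEAST k. \<exists>\<C>. partition_on (verts G) \<C> \<and> card \<C> = k \<and>
     (\<forall>C\<in>\<C>. \<forall>u\<in>C. \<forall>v\<in>C. same_signed_type G u v))"

definition vertex_cover_number :: "'a sgraph \<Rightarrow> nat" where
  "vertex_cover_number G = (LEAST k. \<exists>S. S \<subseteq> verts G \<and> card S = k \<and>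
     (\<forall>e \<in> pos G \<union> neg G. e \<inter> S \<noteq> {}))"

definition complete_sgraph :: "'a sgraph \<Rightarrow> bool" where
  "complete_sgraph G \<longleftrightarrow> signed_graph G \<and> pos G \<union> neg G = nsets (verts G) 2"

definition components :: "'a set \<Rightarrow> 'a set set \<Rightarrow> 'a set set" where
  "components V E = V // ({(u, v). {u, v} \<in> E}\<^sup>* \<inter> V \<times> V)"

text \<open>
  Balance of a complete signed graph is understood in the sense of clusterability (Davis): the
  vertices split into \<open>k\<close> classes such that positive edges run inside the classes and negative
  edges between them.  The classes are then the connected components of the positive graph.
  Merely counting the components of the positive graph would not be enough: a positive path
  whose complement is entirely negative has one positive component, although its negative
  edges all lie inside that component.  Anti-balance is balance after exchanging the signs.
\<close>

definition k_balanced_complete :: "nat \<Rightarrow> 'a sgraph \<Rightarrow> bool" where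
  "k_balanced_complete k G \<longleftrightarrow> complete_sgraph G \<and>
     card (components (verts G) (pos G)) = k \<and>
     (\<forall>C \<in> components (verts G) (pos G). \<forall>e \<in> neg G. \<not> e \<subseteq> C)"

definition k_anti_balanced_complete :: "nat \<Rightarrow> 'a sgraph \<Rightarrow> bool" where
  "k_anti_balanced_complete k G \<longleftrightarrow> complete_sgraph G \<and>
     card (components (verts G) (neg G)) = k \<and>
     (\<forall>C \<in> components (verts G) (neg G). \<forall>e \<in> pos G. \<not> e \<subseteq> C)"

definition delete_verts :: "'a sgraph \<Rightarrow> 'a set \<Rightarrow> 'a sgraph" where
  "delete_verts G S = \<lparr>verts = verts G - S,
     pos = {e \<in> pos G. e \<inter> S = {}}, neg = {e \<in> neg G. e \<inter> S = {}}\<rparr>"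

text \<open>The distance is \<open>\<infinity>\<close> if no deletion set exists.\<close>

definition deletion_distance :: "('a sgraph \<Rightarrow> bool) \<Rightarrow> 'a sgraph \<Rightarrow> enat" where
  "deletion_distance Q G =
     (INF S \<in> {S. S \<subseteq> verts G \<and> Q (delete_verts G S)}. enat (card S))"


section \<open>Turing machines\<close>

text \<open>
  Deterministic machines with one two-way infinite tape.  States and tape symbols are initial
  segments of the natural numbers.  State 0 is initial, state 1 accepts, state 2 rejects;
  symbol 0 is the blank, symbols 1 and 2 encode the input bits.
\<close>

record tm =
  num_states :: nat
  num_symbols :: nat
  delta :: "nat \<Rightarrow> nat \<Rightarrow> nat \<times> nat \<times> int"

definition turing_machine :: "tm \<Rightarrow> bool" where
  "turing_machine M \<longleftrightarrow> num_states M \<ge> 3 \<and> num_symbols M \<ge> 3 \<and>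
     (\<forall>q < num_states M. \<forall>a < num_symbols M. \<forall>q' a' d. delta M q a = (q', a', d) \<longrightarrow>
        q' < num_states M \<and> a' < num_symbols M \<and> d \<in> {-1, 0, 1})"

type_synonym config = "nat \<times> (int \<Rightarrow> nat) \<times> int"

definition halted :: "config \<Rightarrow> bool" where
  "halted c \<longleftrightarrow> fst c \<in> {1, 2}"

fun step :: "tm \<Rightarrow> config \<Rightarrow> config" where
  "step M (q, T, h) =
     (if halted (q, T, h) then (q, T, h)
      else (case delta M q (T h) of (q', a, d) \<Rightarrow> (q', T(h := a), h + d)))"

definition initial :: "bool list \<Rightarrow> config" where
  "initial w = (0, (\<lambda>i. if 0 \<le> i \<and> i < int (length w)
     then (if w ! nat i then 2 else 1) else 0), 0)"

definition run :: "tm \<Rightarrow> bool list \<Rightarrow> nat \<Rightarrow> config" where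
  "run M w t = (step M ^^ t) (initial w)"

definition halts :: "tm \<Rightarrow> bool list \<Rightarrow> bool" where
  "halts M w \<longleftrightarrow> (\<exists>t. halted (run M w t))"

definition run_time :: "tm \<Rightarrow> bool list \<Rightarrow> nat" where
  "run_time M w = (LEAST t. halted (run M w t))"

definition accepts :: "tm \<Rightarrow> bool list \<Rightarrow> bool" where
  "accepts M w \<longleftrightarrow> (\<exists>t. fst (run M w t) = 1)"


section \<open>Computable functions\<close>

text \<open>
  Kleene's total recursive functions.  \<open>recursive n F\<close> is meaningful for argument lists of
  length \<open>n\<close> only.  Minimisation is restricted to regular functions.
\<close>

inductive recursive :: "nat \<Rightarrow> (nat list \<Rightarrow> nat) \<Rightarrow> bool" where
  zero: "recursive n (\<lambda>_. 0)"
| succ: "recursive 1 (\<lambda>xs. Suc (hd xs))"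
| proj: "i < n \<Longrightarrow> recursive n (\<lambda>xs. xs ! i)"
| compose: "recursive (length fs) g \<Longrightarrow> \<forall>f \<in> set fs. recursive n f \<Longrightarrow>
    recursive n (\<lambda>xs. g (map (\<lambda>f. f xs) fs))"
| prim_rec: "recursive n g \<Longrightarrow> recursive (Suc (Suc n)) h \<Longrightarrow>
    recursive (Suc n) (\<lambda>xs. rec_nat (g (tl xs)) (\<lambda>y r. h (y # r # tl xs)) (hd xs))"
| minimise: "recursive (Suc n) g \<Longrightarrow> \<forall>xs. length xs = n \<longrightarrow> (\<exists>y. g (y # xs) = 0) \<Longrightarrow>
    recursive n (\<lambda>xs. LEAST y. g (y # xs) = 0)"

definition computable :: "(nat \<Rightarrow> nat) \<Rightarrow> bool" where
  "computable f \<longleftrightarrow> (\<exists>F. recursive 1 F \<and> (\<forall>n. F [n] = f n))"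


section \<open>Problems on signed graphs and fixed-parameter tractability\<close>

text \<open>
  An instance consists of a signed graph on \<open>{0, ..., n - 1}\<close> and a bit string holding whatever
  else the problem takes as input (a target size, vertex labels, ...; it may be empty).  The
  graph is encoded by \<open>n\<close> in unary followed by its two adjacency matrices.
\<close>

type_synonym sgraph_instance = "nat sgraph \<times> bool list"

definition instances :: "sgraph_instance set" where
  "instances = {(G, x). signed_graph G \<and> (\<exists>n. verts G = {..<n})}"

definition encode_graph :: "nat sgraph \<Rightarrow> bool list" where
  "encode_graph G = (let n = card (verts G) in
     replicate n True @ [False] @
     concat (map (\<lambda>(i, j). [{i, j} \<in> pos G, {i, j} \<in> neg G]) (List.product [0..<n] [0..<n])))"

definition encode :: "sgraph_instance \<Rightarrow> bool list" where
  "encode I = encode_graph (fst I) @ snd I"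

definition decides :: "tm \<Rightarrow> sgraph_instance set \<Rightarrow> bool" where
  "decides M P \<longleftrightarrow>
     (\<forall>I \<in> instances. halts M (encode I) \<and> (accepts M (encode I) \<longleftrightarrow> I \<in> P))"

text \<open>
  The parameterization \<open>\<kappa>\<close> assigns to a graph the set of its parameter values: a singleton for
  an ordinary graph parameter, and one value for each \<open>k\<close> for a parameter that also involves
  an integer \<open>k\<close>.  The time bound has to hold for every value.  The parameter is not
  part of the input of the machine.
\<close>

definition solvable_in_fpt_time :: "sgraph_instance set \<Rightarrow> (nat sgraph \<Rightarrow> nat set) \<Rightarrow> bool" where
  "solvable_in_fpt_time P \<kappa> \<longleftrightarrow>
     (\<exists>M f c. turing_machine M \<and> computable f \<and> decides M P \<and>
        (\<forall>(G, x) \<in> instances. \<forall>p \<in> \<kappa> G.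
           run_time M (encode (G, x)) \<le> f p * length (encode (G, x)) ^ c))"

end

theory Submission
  imports Defs
begin

text \<open>
  The machine that is FPT with respect to the signed neighborhood diversity is itself FPT with
  respect to the other parameters, since each of them bounds \<open>snd\<close> by a computable function.
  Let \<open>S\<close> be a vertex cover or a deletion set.  Two vertices outside \<open>S\<close> have the same signed type
  if they lie in the same balanced component (any two vertices, for a vertex cover) and have the
  same positive and the same negative neighbours in \<open>S\<close>.  Together with the singletons
  of \<open>S\<close> this gives at most \<open>card S + k * 4 ^ card S\<close> classes.
\<close>

section \<open>Closure properties of computable functions\<close>

text \<open>
  Recursive functions carry arbitrary values on lists of the wrong length; comparing values on
  lists of length \<open>n\<close> only makes the closure rules usable up to extensional equality.
\<close>

definition computes :: "nat \<Rightarrow> (nat list \<Rightarrow> nat) \<Rightarrow> bool" where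
  "computes n f \<longleftrightarrow> (\<exists>F. recursive n F \<and> (\<forall>xs. length xs = n \<longrightarrow> F xs = f xs))"

lemma computes_recursive: "recursive n f \<Longrightarrow> computes n f"
  unfolding computes_def by blast

lemma computable_iff_computes: "computable f \<longleftrightarrow> computes 1 (\<lambda>xs. f (hd xs))"
proof -
  have "(\<forall>n. F [n] = f n) \<longleftrightarrow> (\<forall>xs. length xs = 1 \<longrightarrow> F xs = f (hd xs))" for F
    by (auto simp: length_Suc_conv)
  then show ?thesis
    unfolding computable_def computes_def by simp
qed

lemma computes_compose1:
  assumes "computes 1 g" "computes n f"
  shows "computes n (\<lambda>xs. g [f xs])"
proof -
  obtain G F where G: "recursive 1 G" "\<And>xs. length xs = 1 \<Longrightarrow> G xs = g xs"
    and F: "recursive n F" "\<And>xs. length xs = n \<Longrightarrow> F xs = f xs"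
    using assms unfolding computes_def by blast
  have "recursive n (\<lambda>xs. G (map (\<lambda>f. f xs) [F]))"
    using G(1) F(1) by (intro recursive.compose) simp_all
  then show ?thesis
    unfolding computes_def using G(2) F(2) by (intro exI conjI) auto
qed

lemma computes_compose2:
  assumes "computes 2 g" "computes n f1" "computes n f2"
  shows "computes n (\<lambda>xs. g [f1 xs, f2 xs])"
proof -
  obtain G F1 F2 where G: "recursive 2 G" "\<And>xs. length xs = 2 \<Longrightarrow> G xs = g xs"
    and F1: "recursive n F1" "\<And>xs. length xs = n \<Longrightarrow> F1 xs = f1 xs"
    and F2: "recursive n F2" "\<And>xs. length xs = n \<Longrightarrow> F2 xs = f2 xs"
    using assms unfolding computes_def by blast
  have "recursive n (\<lambda>xs. G (map (\<lambda>f. f xs) [F1, F2]))"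
    using G(1) F1(1) F2(1) by (intro recursive.compose) (simp_all add: numeral_2_eq_2)
  then show ?thesis
    unfolding computes_def using G(2) F1(2) F2(2) by (intro exI conjI) auto
qed

text \<open>For \<open>xs\<close> of length \<open>Suc n\<close>, the base is called on
  \<open>n\<close> arguments and the step on \<open>Suc (Suc n)\<close>, exactly the lengths on
  which \<open>G\<close> and \<open>H\<close> agree with \<open>g\<close> and
  \<open>h\<close>.\<close>

lemma computes_prim_rec:
  assumes "computes n g" "computes (Suc (Suc n)) h"
  shows "computes (Suc n) (\<lambda>xs. rec_nat (g (tl xs)) (\<lambda>y r. h (y # r # tl xs)) (hd xs))"
proof -
  obtain G H where G: "recursive n G" "\<And>xs. length xs = n \<Longrightarrow> G xs = g xs"
    and H: "recursive (Suc (Suc n)) H" "\<And>xs. length xs = Suc (Suc n) \<Longrightarrow> H xs = h xs"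
    using assms unfolding computes_def by blast
  show ?thesis
    unfolding computes_def using recursive.prim_rec[OF G(1) H(1)] G(2) H(2)
    by (intro exI conjI) auto
qed

lemma computes_Suc:
  assumes "computes n f"
  shows "computes n (\<lambda>xs. Suc (f xs))"
  using computes_compose1[OF computes_recursive[OF recursive.succ] assms] by simp

lemma computes_const: "computes n (\<lambda>_. c)"
  by (induction c) (auto intro: computes_Suc computes_recursive recursive.zero)

lemma computes_nth: "i < n \<Longrightarrow> computes n (\<lambda>xs. xs ! i)"
  by (intro computes_recursive recursive.proj)

lemma computes_add:
  assumes "computes n f" "computes n g"
  shows "computes n (\<lambda>xs. f xs + g xs)"
proof -
  have rec_Suc: "rec_nat b (\<lambda>_. Suc) a = a + b" for a b :: nat
    by (induction a) auto
  \<comment> \<open>Addition by recursion on the first summand: index 1 of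
    \<open>y # r # tl xs\<close> is the previous value \<open>r\<close>, and the base case is the
    second summand.\<close>
  have "computes (Suc 1) (\<lambda>xs. rec_nat (tl xs ! 0) (\<lambda>y r. Suc ((y # r # tl xs) ! 1)) (hd xs))"
    by (rule computes_prim_rec[where g = "\<lambda>xs. xs ! 0" and h = "\<lambda>xs. Suc (xs ! 1)"])
      (auto intro: computes_nth computes_Suc)
  then have "computes 2 (\<lambda>xs. hd xs + tl xs ! 0)"
    by (simp add: rec_Suc numeral_2_eq_2)
  from computes_compose2[OF this assms] show ?thesis
    by simp
qed

lemma computes_computable:
  assumes "computable f" "computes n g"
  shows "computes n (\<lambda>xs. f (g xs))"
  using computes_compose1[OF assms(1)[unfolded computable_iff_computes] assms(2)] by simp

lemma computable_rec_nat:
  assumes "computes 2 (\<lambda>xs. h (xs ! 0) (xs ! 1))"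
  shows "computable (rec_nat c h)"
  using computes_prim_rec[OF computes_const[of 0 c], of "\<lambda>xs. h (xs ! 0) (xs ! 1)"] assms
  by (simp add: computable_iff_computes numeral_2_eq_2)

text \<open>Supplies a computable monotone majorant: the sum dominates every \<open>f i\<close> with
  \<open>i \<le> n\<close>, even if \<open>f\<close> itself is not monotone.\<close>

lemma computable_sum_atMost:
  assumes "computable f"
  shows "computable (\<lambda>n. \<Sum>i\<le>n. f i)"
proof -
  have "computable (rec_nat (f 0) (\<lambda>y r. r + f (Suc y)))"
    by (intro computable_rec_nat computes_add computes_computable[OF assms] computes_Suc
        computes_nth) auto
  moreover have "rec_nat (f 0) (\<lambda>y r. r + f (Suc y)) n = (\<Sum>i\<le>n. f i)" for n
    by (induction n) auto
  ultimately show ?thesis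
    by (rule back_subst[of computable, OF _ ext])
qed

lemma computable_power_8: "computable (\<lambda>n. 8 ^ Suc n)"
proof -
  \<comment> \<open>Three doublings multiply by 8, so addition suffices and multiplication need not
    be shown computable.\<close>
  let ?double = "\<lambda>r::nat. r + r"
  have "computable (rec_nat 8 (\<lambda>_ r. ?double (?double (?double r))))"
    by (intro computable_rec_nat computes_add computes_nth) auto
  moreover have "rec_nat 8 (\<lambda>_ r. ?double (?double (?double r))) n = 8 ^ Suc n" for n
    by (induction n) auto
  ultimately show ?thesis
    by (rule back_subst[of computable, OF _ ext])
qed

lemma computable_compose:
  assumes "computable f" "computable g"
  shows "computable (\<lambda>n. f (g n))"
  using computes_computable[OF assms(1), of 1 "\<lambda>xs. g (hd xs)"] assms(2)
  by (simp add: computable_iff_computes)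


section \<open>Bounds on the signed neighborhood diversity\<close>

lemma snd_number_le_card_image:
  assumes "\<And>u v. u \<in> verts G \<Longrightarrow> v \<in> verts G \<Longrightarrow> \<tau> u = \<tau> v \<Longrightarrow> same_signed_type G u v"
    and "finite (verts G)"
  shows "snd_number G \<le> card (\<tau> ` verts G)"
proof -
  \<comment> \<open>The fibres of \<open>\<tau>\<close>; letting \<open>t\<close> range over the
    image only keeps them nonempty, as a partition demands.\<close>
  define \<C> where "\<C> = (\<lambda>t. {v \<in> verts G. \<tau> v = t}) ` \<tau> ` verts G"
  have "partition_on (verts G) \<C>"
    unfolding \<C>_def by (rule partition_onI) (auto simp: disjnt_def)
  moreover have "\<forall>C\<in>\<C>. \<forall>u\<in>C. \<forall>v\<in>C. same_signed_type G u v"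
    unfolding \<C>_def using assms(1) by auto
  ultimately have "snd_number G \<le> card \<C>"
    unfolding snd_number_def by (intro Least_le) blast
  also have "\<dots> \<le> card (\<tau> ` verts G)"
    unfolding \<C>_def using assms(2) by (intro card_image_le) simp
  finally show ?thesis .
qed

text \<open>Turns the class count into a function of the sum \<open>d + k\<close>, the only value
  the parameter provides: \<open>d + k\<close> is below \<open>2 ^ (d + k)\<close>, and 2 * 4 =
  8.\<close>

lemma modulator_classes_le: "d + k * 4 ^ d \<le> (8::nat) ^ (d + k)"
proof -
  have "d + k * 4 ^ d \<le> (d + k) * 4 ^ d"
    by (simp add: algebra_simps)
  also have "\<dots> \<le> 2 ^ (d + k) * 4 ^ (d + k)"
    by (intro mult_mono) (auto intro: less_imp_le less_exp power_increasing)
  also have "\<dots> = 8 ^ (d + k)"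
    by (simp flip: power_mult_distrib)
  finally show ?thesis .
qed

text \<open>Common core of all three bounds. The labelling \<open>c\<close> is constant for a vertex
  cover and gives the component for a balanced graph; equal labels mean that all third vertices
  outside \<open>S\<close> are seen alike.\<close>

lemma snd_number_le_modulator:
  assumes G: "signed_graph G" and S: "S \<subseteq> verts G"
    and k: "card (c ` (verts G - S)) \<le> k"
    and c: "\<And>u v w. u \<in> verts G - S \<Longrightarrow> v \<in> verts G - S \<Longrightarrow> c u = c v \<Longrightarrow>
      w \<in> verts G - S \<Longrightarrow> w \<noteq> u \<Longrightarrow> w \<noteq> v \<Longrightarrow>
      ({u, w} \<in> pos G \<longleftrightarrow> {v, w} \<in> pos G) \<and> ({u, w} \<in> neg G \<longleftrightarrow> {v, w} \<in> neg G)"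
  shows "snd_number G \<le> 8 ^ (card S + k)"
proof -
  \<comment> \<open>\<open>\<sigma>\<close> refines \<open>c\<close> by the two traces on
    \<open>S\<close>; in \<open>\<tau>\<close>, \<open>Inl\<close> makes each vertex of
    \<open>S\<close> a class of its own.\<close>
  define \<sigma> where "\<sigma> v = (c v, nbh (pos G) v \<inter> S, nbh (neg G) v \<inter> S)" for v
  define \<tau> where "\<tau> v = (if v \<in> S then Inl v else Inr (\<sigma> v))" for v
  have fin: "finite (verts G)"
    using G by (simp add: signed_graph_def)
  then have finS: "finite S"
    using S finite_subset by blast
  have edge: "w \<in> verts G \<and> w \<noteq> v" if "{v, w} \<in> pos G \<union> neg G" for v w
    using that G by (auto simp: signed_graph_def nsets_def card_2_iff doubleton_eq_iff)
  have type: "same_signed_type G u v"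
    if uv: "u \<in> verts G" "v \<in> verts G" "\<tau> u = \<tau> v" for u v
  proof (cases "u \<in> S \<or> v \<in> S")
    case True
    then have "u = v"
      using uv(3) by (auto simp: \<tau>_def split: if_splits)
    then show ?thesis
      by (simp add: same_signed_type_def)
  next
    case False
    then have eq: "c u = c v" "nbh (pos G) u \<inter> S = nbh (pos G) v \<inter> S"
      "nbh (neg G) u \<inter> S = nbh (neg G) v \<inter> S"
      using uv(3) by (auto simp: \<tau>_def \<sigma>_def)
    have "(w \<in> nbh (pos G) u \<longleftrightarrow> w \<in> nbh (pos G) v) \<and>
        (w \<in> nbh (neg G) u \<longleftrightarrow> w \<in> nbh (neg G) v)"
      if w: "w \<noteq> u" "w \<noteq> v" for w
    proof (cases "w \<in> verts G - S")
      case True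
      then show ?thesis
        using c[of u v w] uv eq(1) False w by (simp add: nbh_def insert_commute)
    next
      case False
      then consider "w \<in> S" | "w \<notin> verts G"
        by blast
      then show ?thesis
      proof cases
        case 1
        then show ?thesis
          using eq(2,3) by blast
      next
        case 2
        then show ?thesis
          using edge[of u w] edge[of v w] by (auto simp: nbh_def insert_commute)
      qed
    qed
    \<comment> \<open>Settles \<open>w = u\<close> and \<open>w = v\<close>: one side of the type
      condition removes \<open>w\<close> explicitly, and on the other side \<open>w\<close> would
      have to be its own neighbour.\<close>
    moreover have "z \<notin> nbh (pos G) z" "z \<notin> nbh (neg G) z" for z
      using edge[of z z] by (auto simp: nbh_def)
    ultimately show ?thesis
      unfolding same_signed_type_def set_eq_iff Diff_iff singleton_iff by metis
  qed
  have "\<tau> ` verts G \<subseteq> Inl ` S \<union> Inr ` (c ` (verts G - S) \<times> Pow S \<times> Pow S)"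
    by (auto simp: \<tau>_def \<sigma>_def)
  then have "card (\<tau> ` verts G) \<le> card (Inl ` S \<union> Inr ` (c ` (verts G - S) \<times> Pow S \<times> Pow S))"
    using fin finS by (intro card_mono) auto
  also have "\<dots> \<le> card S + card (c ` (verts G - S) \<times> Pow S \<times> Pow S)"
    by (rule order.trans[OF card_Un_le]) (simp add: card_image)
  \<comment> \<open>Each trace has \<open>2 ^ card S\<close> possible values, so the pair has
    \<open>4 ^ card S\<close>.\<close>
  also have "\<dots> = card S + card (c ` (verts G - S)) * 4 ^ card S"
    using finS by (simp add: card_cartesian_product card_Pow flip: power_mult_distrib)
  also have "\<dots> \<le> card S + k * 4 ^ card S"
    using k by simp
  also have "\<dots> \<le> 8 ^ (card S + k)"
    by (rule modulator_classes_le)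
  finally show ?thesis
    using snd_number_le_card_image[of G \<tau>, OF type fin] by linarith
qed

text \<open>No edge avoids a minimum cover \<open>S\<close>, so one label does for all vertices
  outside it; this label accounts for the \<open>Suc\<close>.\<close>

lemma snd_number_le_vertex_cover_number:
  assumes "signed_graph G"
  shows "snd_number G \<le> 8 ^ Suc (vertex_cover_number G)"
proof -
  let ?cover = "\<lambda>k S. S \<subseteq> verts G \<and> card S = k \<and> (\<forall>e \<in> pos G \<union> neg G. e \<inter> S \<noteq> {})"
  have "e \<subseteq> verts G \<and> e \<noteq> {}" if "e \<in> pos G \<union> neg G" for e
    using assms that by (auto simp: signed_graph_def nsets_def)
  then have "?cover (card (verts G)) (verts G)"
    by blast
  then have "\<exists>k S. ?cover k S"
    by blast
  then have "\<exists>S. ?cover (vertex_cover_number G) S"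
    unfolding vertex_cover_number_def by (rule LeastI_ex)
  then obtain S where S: "?cover (vertex_cover_number G) S" ..
  \<comment> \<open>Only an inequality, since the cover may be all of
    \<open>verts G\<close>.\<close>
  have "card ((\<lambda>_. ()) ` (verts G - S)) \<le> 1"
    by (rule order.trans[OF card_mono[of UNIV]]) auto
  moreover have "{u, w} \<notin> pos G \<union> neg G" if "{u, w} \<inter> S = {}" for u w
    using S that by blast
  ultimately have "snd_number G \<le> 8 ^ (card S + 1)"
    using S by (intro snd_number_le_modulator[OF assms, where c = "\<lambda>_. ()"]) auto
  then show ?thesis
    using S by simp
qed

text \<open>A finite distance rules out an empty family of deletion sets, and the infimum of a
  nonempty set of extended naturals is its least element.\<close>

lemma deletion_distance_attained:
  assumes "deletion_distance Q G = enat d"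
  obtains S where "S \<subseteq> verts G" "Q (delete_verts G S)" "card S = d"
proof -
  let ?A = "(\<lambda>S. enat (card S)) ` {S. S \<subseteq> verts G \<and> Q (delete_verts G S)}"
  have Inf: "Inf ?A = enat d"
    using assms by (simp add: deletion_distance_def)
  then have "?A \<noteq> {}"
    by (metis Inf_empty top_enat_def enat.distinct(1))
  then have "Inf ?A \<in> ?A"
    unfolding Inf_enat_def by (simp only: if_False) (rule LeastI_ex, simp only: ex_in_conv simp_thms)
  then show ?thesis
    unfolding Inf using that by auto
qed

text \<open>After deleting an optimal \<open>S\<close>, the sign of a pair only depends on whether
  its ends share a component, and there are \<open>k\<close> components.\<close>

lemma snd_number_le_balanced:
  assumes G: "signed_graph G"
    and dist: "enat p = deletion_distance (k_balanced_complete k) G + enat k"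
  shows "snd_number G \<le> 8 ^ p"
proof -
  obtain d where d: "deletion_distance (k_balanced_complete k) G = enat d"
    using dist by (cases "deletion_distance (k_balanced_complete k) G") auto
  then have p: "p = d + k"
    using dist by simp
  obtain S where S: "S \<subseteq> verts G" "k_balanced_complete k (delete_verts G S)" "card S = d"
    using deletion_distance_attained[OF d] .
  define V where "V = verts G - S"
  define E where "E = {e \<in> pos G. e \<inter> S = {}}"
  define F where "F = {e \<in> neg G. e \<inter> S = {}}"
  define R where "R = {(u, v). {u, v} \<in> E}\<^sup>* \<inter> V \<times> V"
  have complete: "E \<union> F = nsets V 2" and k: "card (V // R) = k"
    and bal: "\<And>C e. C \<in> V // R \<Longrightarrow> e \<in> F \<Longrightarrow> \<not> e \<subseteq> C"
    using S(2) by (auto simp: k_balanced_complete_def complete_sgraph_def components_def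
        delete_verts_def V_def E_def F_def R_def)
  have "sym ({(u, v). {u, v} \<in> E}\<^sup>*)"
    by (rule sym_rtrancl) (auto simp: sym_def insert_commute)
  then have equiv: "equiv V R"
    by (intro equivI) (auto simp: R_def refl_on_def sym_def trans_def)
  \<comment> \<open>Completeness gives the pair a sign; a positive edge joins its ends in
    \<open>R\<close>, and balance forbids a negative edge inside a class of
    \<open>R\<close>.\<close>
  have pos_iff: "{u, w} \<in> pos G \<longleftrightarrow> (u, w) \<in> R" and neg_iff: "{u, w} \<in> neg G \<longleftrightarrow> (u, w) \<notin> R"
    if uw: "u \<in> V" "w \<in> V" "u \<noteq> w" for u w
  proof -
    have notS: "{u, w} \<inter> S = {}"
      using uw by (auto simp: V_def)
    have "{u, w} \<in> nsets V 2"
      using uw by (simp add: nsets_def)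
    then have "{u, w} \<in> pos G \<or> {u, w} \<in> neg G"
      unfolding complete[symmetric] by (auto simp: E_def F_def)
    moreover have "(u, w) \<in> R" if "{u, w} \<in> pos G"
      using that notS uw by (auto simp: R_def E_def)
    moreover have "(u, w) \<notin> R" if "{u, w} \<in> neg G"
    proof
      assume "(u, w) \<in> R"
      then have "{u, w} \<subseteq> R `` {u}"
        using equiv_class_self[OF equiv uw(1)] by simp
      moreover have "R `` {u} \<in> V // R" "{u, w} \<in> F"
        using that notS uw by (auto simp: F_def intro: quotientI)
      ultimately show False
        using bal by blast
    qed
    ultimately show "{u, w} \<in> pos G \<longleftrightarrow> (u, w) \<in> R" "{u, w} \<in> neg G \<longleftrightarrow> (u, w) \<notin> R"
      by blast+
  qed
  \<comment> \<open>With \<open>R\<close>-classes as labels, equal labels say that both vertices are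
    related to the same vertices, so \<open>pos_iff\<close> and \<open>neg_iff\<close> give equal
    signs.\<close>
  have "(\<lambda>v. R `` {v}) ` V = V // R"
    by (auto simp: quotient_def)
  then have "snd_number G \<le> 8 ^ (card S + k)"
    using k pos_iff neg_iff
    by (intro snd_number_le_modulator[OF G S(1), where c = "\<lambda>v. R `` {v}"])
      (auto simp flip: V_def)
  then show ?thesis
    using S(3) p by simp
qed

text \<open>Reduces anti-balance to balance: the exchange commutes with deletion and preserves
  signed types, which treat both signs symmetrically.\<close>

definition swap_signs :: "'a sgraph \<Rightarrow> 'a sgraph" where
  "swap_signs G = \<lparr>verts = verts G, pos = neg G, neg = pos G\<rparr>"

lemma snd_number_swap_signs: "snd_number (swap_signs G) = snd_number G"
proof -
  have "same_signed_type (swap_signs G) = same_signed_type G"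
    by (auto simp: fun_eq_iff same_signed_type_def swap_signs_def)
  then show ?thesis
    by (simp add: snd_number_def) (simp add: swap_signs_def)
qed

lemma signed_graph_swap_signs: "signed_graph (swap_signs G) \<longleftrightarrow> signed_graph G"
  by (auto simp: signed_graph_def swap_signs_def)

lemma k_balanced_complete_swap_signs:
  "k_balanced_complete k (swap_signs G) \<longleftrightarrow> k_anti_balanced_complete k G"
  unfolding k_balanced_complete_def k_anti_balanced_complete_def complete_sgraph_def
    signed_graph_swap_signs
  by (simp add: swap_signs_def Un_commute)

lemma deletion_distance_swap_signs:
  "deletion_distance (k_balanced_complete k) (swap_signs G) =
    deletion_distance (k_anti_balanced_complete k) G"
proof -
  have "delete_verts (swap_signs G) S = swap_signs (delete_verts G S)" for S
    by (simp add: delete_verts_def swap_signs_def)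
  moreover have "verts (swap_signs G) = verts G"
    by (simp add: swap_signs_def)
  ultimately show ?thesis
    by (simp add: deletion_distance_def k_balanced_complete_swap_signs)
qed

lemma snd_number_le_anti_balanced:
  assumes "signed_graph G"
    and "enat p = deletion_distance (k_anti_balanced_complete k) G + enat k"
  shows "snd_number G \<le> 8 ^ p"
  using snd_number_le_balanced[of "swap_signs G" p k] assms
  by (simp add: snd_number_swap_signs signed_graph_swap_signs deletion_distance_swap_signs)


section \<open>Transfer of fixed-parameter tractability\<close>

text \<open>The machine never receives the parameter, so it can be kept and only its time bound
  changes. As \<open>f\<close> may fail to be monotone, \<open>f q\<close> is bounded by the sum of
  \<open>f\<close> up to \<open>g p\<close>.\<close>

lemma solvable_in_fpt_time_mono:
  assumes "solvable_in_fpt_time P \<mu>" "computable g"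
    and bound: "\<And>G p. signed_graph G \<Longrightarrow> p \<in> \<kappa> G \<Longrightarrow> \<exists>q \<in> \<mu> G. q \<le> g p"
  shows "solvable_in_fpt_time P \<kappa>"
proof -
  obtain M f c where M: "turing_machine M" "computable f" "decides M P"
    and time: "\<forall>(G, x) \<in> instances. \<forall>q \<in> \<mu> G.
      run_time M (encode (G, x)) \<le> f q * length (encode (G, x)) ^ c"
    using assms(1) unfolding solvable_in_fpt_time_def by blast
  define f' where "f' p = (\<Sum>i\<le>g p. f i)" for p
  have "computable f'"
    unfolding f'_def
    using computable_compose[OF computable_sum_atMost[OF M(2)] assms(2)] .
  moreover have "run_time M (encode (G, x)) \<le> f' p * length (encode (G, x)) ^ c"
    if I: "(G, x) \<in> instances" and p: "p \<in> \<kappa> G" for G x p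
  proof -
    obtain q where q: "q \<in> \<mu> G" "q \<le> g p"
      using bound[of G p] I p by (auto simp: instances_def)
    have "f q \<le> f' p"
      unfolding f'_def using q(2) by (intro member_le_sum) auto
    moreover have "run_time M (encode (G, x)) \<le> f q * length (encode (G, x)) ^ c"
      using time I q(1) by blast
    ultimately show ?thesis
      by (meson mult_le_mono1 order.trans)
  qed
  ultimately show ?thesis
    unfolding solvable_in_fpt_time_def using M(1,3) by blast
qed

theorem theorem9:
  fixes P :: "sgraph_instance set"
  assumes "solvable_in_fpt_time P (\<lambda>G. {snd_number G})"
  shows "solvable_in_fpt_time P (\<lambda>G. {vertex_cover_number G}) \<and>
    solvable_in_fpt_time P
      (\<lambda>G. {p. \<exists>k. enat p = deletion_distance (k_balanced_complete k) G + enat k}) \<and>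
    solvable_in_fpt_time P
      (\<lambda>G. {p. \<exists>k. enat p = deletion_distance (k_anti_balanced_complete k) G + enat k})"
proof -
  note transfer = solvable_in_fpt_time_mono[OF assms computable_power_8]
  \<comment> \<open>The transfer function \<open>8 ^ Suc p\<close> is dictated by the vertex cover;
    the two distance bounds \<open>8 ^ p\<close> are weakened to match.\<close>
  have Suc_bound: "m \<le> 8 ^ p \<Longrightarrow> m \<le> 8 ^ Suc p" for m p :: nat
    by simp
  show ?thesis
    by (intro conjI transfer)
      (auto simp del: power_Suc intro: snd_number_le_vertex_cover_number Suc_bound
        snd_number_le_balanced snd_number_le_anti_balanced)
qed

end
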